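(* For each $r>0$ let $b_r^*\ge 0$ be the optimal periodic barrier defined in the context, and let $\bar b$ be the classical barrier defined there. Then: 1. $b_r^*$ is increasing in $r$ (in the weak sense: $r\le r'$ implies $b_r^*\le b_{r'}^*$). 2. $b_r^*\to\bar b$ as $r\to\infty$. 3. When $W^{(q)\prime}(0+)<\infty$, $b_r^*=0$ for all sufficiently small $r>0$. When $W^{(q)\prime}(0+)=\infty$, $b_r^*\to 0$ as $r\to 0$.
   Context: $X=(X(t);t\ge 0)$ is a spectrally negative Lévy process (no positive jumps, not the negative of a subordinator) with Laplace exponent $$\psi(\theta)=\log\mathbb{E}[e^{\theta X(1)}]=\gamma\theta+\tfrac{\eta^2}{2}\theta^2+\int_{(-\infty,0)}(e^{\theta z}-1-\theta z\mathbf{1}_{\{z>-1\}})\Pi(dz),\quad \theta\ge 0,$$ with $\gamma\in\mathbb{R}$, $\eta\ge 0$, $\int_{(-\infty,0)}(1\wedge z^2)\Pi(dz)<\infty$. Standing assumption: the Lévy measure of $-X$ (the image of $\Pi$ under $z\mapsto -z$) has a density $\pi$ on $(0,\infty)$ whose derivatives $\pi^{(n)}$ of all orders exist and satisfy $(-1)^n\pi^{(n)}(x)\ge 0$ for all $x>0$, $n\ge 1$. Fix $q>0$. For $p>0$, $\Phi(p)=\sup\{\lambda\ge 0:\psi(\lambda)=p\}$, and the scale function $W^{(q)}:\mathbb{R}\to[0,\infty)$ vanishes on $(-\infty,0)$, is continuous and strictly increasing on $[0,\infty)$, and satisfies $\int_0^\infty e^{-\theta x}W^{(q)}(x)dx=1/(\psi(\theta)-q)$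 for $\theta>\Phi(q)$. Under the standing assumption it is known that $W^{(q)}$ is infinitely differentiable on $(0,\infty)$, and that there is $\bar b\in[0,\infty)$ with $W^{(q)\prime\prime}<0$ on $(0,\bar b)$ and $W^{(q)\prime\prime}>0$ on $(\bar b,\infty)$; this defines $\bar b$. $W^{(q)\prime}(0+)$ denotes $\lim_{x\downarrow 0}W^{(q)\prime}(x)\in(0,\infty]$. For $r>0$ and $b>0$ set $$Z^{(q)}(b,\Phi(q+r))=e^{\Phi(q+r)b}\Big(1-r\int_0^be^{-\Phi(q+r)z}W^{(q)}(z)dz\Big),$$ $$Z^{(q)\prime}(b,\Phi(q+r))=\Phi(q+r)Z^{(q)}(b,\Phi(q+r))-rW^{(q)}(b),$$ $$h^{(r)}(b)=e^{-\Phi(q+r)b}\big[rW^{(q)\prime}(b)-\Phi(q+r)Z^{(q)\prime}(b,\Phi(q+r))\big].$$ If $h^{(r)}(0+)>0$, equivalently $r\big(W^{(q)\prime}(0+)+\Phi(q+r)W^{(q)}(0)\big)>\Phi(q+r)^2$, then $b_r^*$ is the (unique) number in $(0,\bar b)$ such that $h^{(r)}(b_r^* )=0$ and $\{b>0:h^{(r)}(b)\ge 0\}=(0,b_r^*]$. Otherwise $b_r^*=0$. *)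

theory Defs
  imports "HOL-Probability.Probability"
begin

definition smooth_on_pos :: "(real \<Rightarrow> real) \<Rightarrow> bool" where
  "smooth_on_pos f \<longleftrightarrow> (\<forall>n. \<forall>x>0. (deriv ^^ n) f field_differentiable (at x))"

definition levy_process :: "'a measure \<Rightarrow> (real \<Rightarrow> 'a \<Rightarrow> real) \<Rightarrow> bool" where
  "levy_process M X \<longleftrightarrow>
     prob_space M \<and>
     (\<forall>t\<ge>0. X t \<in> borel_measurable M) \<and>
     (AE \<omega> in M. X 0 \<omega> = 0) \<and>
     (\<forall>n (t :: nat \<Rightarrow> real). 0 \<le> t 0 \<and> (\<forall>i<n. t i \<le> t (Suc i)) \<longrightarrow>
        prob_space.indep_vars M (\<lambda>_. borel) (\<lambda>i \<omega>. X (t (Suc i)) \<omega> - X (t i) \<omega>) {..<n}) \<and>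
     (\<forall>s\<ge>0. \<forall>t\<ge>0.
        distr M borel (\<lambda>\<omega>. X (s + t) \<omega> - X s \<omega>) = distr M borel (X t)) \<and>
     (AE \<omega> in M.
        (\<forall>t\<ge>0. ((\<lambda>s. X s \<omega>) \<longlongrightarrow> X t \<omega>) (at_right t)) \<and>
        (\<forall>t>0. \<exists>l. ((\<lambda>s. X s \<omega>) \<longlongrightarrow> l) (at_left t)))"

text \<open>The last conjunct excludes negatives of subordinators (in particular the zero process).\<close>

definition spectrally_negative_levy :: "'a measure \<Rightarrow> (real \<Rightarrow> 'a \<Rightarrow> real) \<Rightarrow> bool" where
  "spectrally_negative_levy M X \<longleftrightarrow>
     levy_process M X \<and>
     (AE \<omega> in M. \<forall>t>0. \<forall>l. ((\<lambda>s. X s \<omega>) \<longlongrightarrow> l) (at_left t) \<longrightarrow> X t \<omega> \<le> l) \<and>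
     \<not> (AE \<omega> in M. \<forall>s t. 0 \<le> s \<and> s \<le> t \<longrightarrow> X t \<omega> \<le> X s \<omega>)"

definition neg_levy_measure :: "real measure \<Rightarrow> bool" where
  "neg_levy_measure \<nu> \<longleftrightarrow>
     sets \<nu> = sets borel \<and>
     emeasure \<nu> {0..} = 0 \<and>
     (\<integral>\<^sup>+ z. ennreal (min 1 (z\<^sup>2)) \<partial>\<nu>) < \<infinity>"

definition laplace_exponent :: "real \<Rightarrow> real \<Rightarrow> real measure \<Rightarrow> real \<Rightarrow> real" where
  "laplace_exponent \<gamma> \<eta> \<nu> \<theta> =
     \<gamma> * \<theta> + \<eta>\<^sup>2 / 2 * \<theta>\<^sup>2 +
     (LINT z:{..<0}|\<nu>. exp (\<theta> * z) - 1 - \<theta> * z * indicator {-1<..} z)"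

text \<open>The pushforward of \<open>\<nu>\<close> under negation is the Levy measure of \<open>-X\<close>.\<close>

definition dual_levy_density :: "real measure \<Rightarrow> (real \<Rightarrow> real) \<Rightarrow> bool" where
  "dual_levy_density \<nu> \<pi> \<longleftrightarrow>
     (\<forall>x>0. \<pi> x \<ge> 0) \<and>
     distr \<nu> borel uminus = density lborel (\<lambda>x. ennreal (indicator {0<..} x * \<pi> x))"

definition completely_monotone_derivs :: "(real \<Rightarrow> real) \<Rightarrow> bool" where
  "completely_monotone_derivs \<pi> \<longleftrightarrow>
     smooth_on_pos \<pi> \<and> (\<forall>n\<ge>1. \<forall>x>0. (-1) ^ n * (deriv ^^ n) \<pi> x \<ge> 0)"

definition right_inverse :: "(real \<Rightarrow> real) \<Rightarrow> real \<Rightarrow> real" where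
  "right_inverse \<psi> p = Sup {y. y \<ge> 0 \<and> \<psi> y = p}"

definition scale_function :: "(real \<Rightarrow> real) \<Rightarrow> real \<Rightarrow> (real \<Rightarrow> real) \<Rightarrow> bool" where
  "scale_function \<psi> q W \<longleftrightarrow>
     (\<forall>x. W x \<ge> 0) \<and> (\<forall>x<0. W x = 0) \<and>
     continuous_on {0..} W \<and> strict_mono_on {0..} W \<and>
     (\<forall>\<theta> > right_inverse \<psi> q.
        ((\<lambda>x. exp (- \<theta> * x) * W x) has_integral 1 / (\<psi> \<theta> - q)) {0..})"

definition classical_barrier :: "(real \<Rightarrow> real) \<Rightarrow> real \<Rightarrow> bool" where
  "classical_barrier W bbar \<longleftrightarrow>
     bbar \<ge> 0 \<and>
     (\<forall>x. 0 < x \<and> x < bbar \<longrightarrow> deriv (deriv W) x < 0) \<and>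
     (\<forall>x>bbar. deriv (deriv W) x > 0)"

text \<open>Right limits at zero are taken in the extended reals, since they may be infinite.\<close>

definition lim_at_zero_right :: "(real \<Rightarrow> real) \<Rightarrow> ereal" where
  "lim_at_zero_right f = Lim (at_right 0) (\<lambda>x. ereal (f x))"

definition Zfun :: "(real \<Rightarrow> real) \<Rightarrow> real \<Rightarrow> (real \<Rightarrow> real) \<Rightarrow> real \<Rightarrow> real \<Rightarrow> real" where
  "Zfun \<psi> q W r b =
     (let \<phi> = right_inverse \<psi> (q + r)
      in exp (\<phi> * b) * (1 - r * integral {0..b} (\<lambda>z. exp (- \<phi> * z) * W z)))"

definition Zfun' :: "(real \<Rightarrow> real) \<Rightarrow> real \<Rightarrow> (real \<Rightarrow> real) \<Rightarrow> real \<Rightarrow> real \<Rightarrow> real" where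
  "Zfun' \<psi> q W r b = right_inverse \<psi> (q + r) * Zfun \<psi> q W r b - r * W b"

definition hfun :: "(real \<Rightarrow> real) \<Rightarrow> real \<Rightarrow> (real \<Rightarrow> real) \<Rightarrow> real \<Rightarrow> real \<Rightarrow> real" where
  "hfun \<psi> q W r b =
     (let \<phi> = right_inverse \<psi> (q + r)
      in exp (- \<phi> * b) * (r * deriv W b - \<phi> * Zfun' \<psi> q W r b))"

definition periodic_barrier ::
    "(real \<Rightarrow> real) \<Rightarrow> real \<Rightarrow> (real \<Rightarrow> real) \<Rightarrow> real \<Rightarrow> real \<Rightarrow> real" where
  "periodic_barrier \<psi> q W bbar r =
     (if lim_at_zero_right (hfun \<psi> q W r) > 0
      then THE b. 0 < b \<and> b < bbar \<and> hfun \<psi> q W r b = 0 \<and>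
                  {c. c > 0 \<and> hfun \<psi> q W r c \<ge> 0} = {0<..b}
      else 0)"

end

theory Submission
  imports Defs
begin

text \<open>
  Write \<open>\<phi> r\<close> for the right inverse of \<open>\<psi>\<close> at \<open>q + r\<close>. Since the Laplace transform of \<open>W\<close> at
  \<open>\<phi> r\<close> equals \<open>1 / r\<close>, integrating by parts twice turns the function that defines the
  periodic barrier into
  \<open>hfun \<psi> q W r b = - r * (\<integral> y from b to \<infinity>. exp (- \<phi> r * y) * W'' y)\<close>.
  As \<open>W''\<close> is negative before \<open>bbar\<close> and positive after it, this function decreases up to \<open>bbar\<close>
  and is negative from there on. Hence the barrier \<open>b\<^sub>r\<close> is characterised, whatever the sign of the
  limit at zero, by \<open>c \<le> b\<^sub>r \<longleftrightarrow> hfun \<psi> q W r c \<ge> 0\<close> for \<open>c > 0\<close> (\<open>le_periodic_barrier_iff\<close>), and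
  every claim about \<open>b\<^sub>r\<close> becomes a claim about the sign of the integral.

  \<^item> Monotonicity: increasing \<open>r\<close> increases \<open>\<phi> r\<close>, which multiplies the integrand by a decreasing
    exponential. Normalised to be \<open>1\<close> at \<open>bbar\<close>, this factor enlarges the negative part of the
    integrand and shrinks the positive part (\<open>tail_le_weighted_tail\<close>), so a nonnegative value of
    \<open>hfun\<close> stays nonnegative.
  \<^item> Large \<open>r\<close>: for fixed \<open>c < bbar\<close> the same factor blows up on an interval between \<open>c\<close> and \<open>bbar\<close>
    while the rest stays bounded below, so \<open>hfun \<psi> q W r c > 0\<close> eventually
    (\<open>tail_eventually_pos\<close>).
  \<^item> Small \<open>r\<close>: all terms of \<open>hfun\<close> carry a factor \<open>r\<close> except \<open>- (\<phi> r)\<^sup>2\<close>, which tends to minus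
    the squared right inverse of \<open>\<psi>\<close> at \<open>q\<close>, a negative number. This is uniform over bounded sets of
    points on which \<open>W'\<close> is bounded (\<open>hfun_eventually_neg\<close>), hence uniform near zero when \<open>W'(0+)\<close>
    is finite.

  The improper integral itself is never formed: its closed form \<open>tail\<close> is handled through its
  derivative \<open>exp (- \<theta> * b) * W'' b\<close> and its limit \<open>0\<close> at infinity, which replaces comparison of
  integrals by monotonicity of functions that vanish at infinity.

  The right inverse is well behaved because \<open>\<psi>\<close> is convex, vanishes at \<open>0\<close> and is positive somewhere.
  Convexity is that of a cumulant generating function, and positivity comes from the scale function:
  the Laplace transform \<open>1 / (\<psi> \<theta> - q)\<close> of a nonnegative function cannot be negative.
\<close>

section \<open>Convex exponents and their right inverse\<close>

text \<open>
  With each exponential normalised to have expectation one, convexity of the exponential function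
  bounds the normalised exponential at a convex combination pointwise by the convex combination of
  the normalised exponentials; taking expectations gives the claim.
\<close>

lemma (in prob_space) convex_on_cumulant:
  fixes Y :: "'a \<Rightarrow> real"
  assumes int: "\<And>\<theta>. \<theta> \<ge> 0 \<Longrightarrow> integrable M (\<lambda>\<omega>. exp (\<theta> * Y \<omega>))"
  shows "convex_on {0..} (\<lambda>\<theta>. ln (expectation (\<lambda>\<omega>. exp (\<theta> * Y \<omega>))))"
proof (rule convex_onI)
  define L where "L \<theta> = ln (expectation (\<lambda>\<omega>. exp (\<theta> * Y \<omega>)))" for \<theta>
  have pos: "expectation (\<lambda>\<omega>. exp (\<theta> * Y \<omega>)) > 0" if "\<theta> \<ge> 0" for \<theta>
    using integral_less_AE_space[of "\<lambda>_. 0" "\<lambda>\<omega>. exp (\<theta> * Y \<omega>)"] int[OF that]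
    by (simp add: emeasure_space_1)
  have expL: "exp (- L \<theta>) * expectation (\<lambda>\<omega>. exp (\<theta> * Y \<omega>)) = 1" if "\<theta> \<ge> 0" for \<theta>
    using pos[OF that] by (simp add: L_def exp_minus)
  fix t x y :: real
  assume t: "0 < t" "t < 1" and x: "x \<in> {0..}" and y: "y \<in> {0..}"
  define s where "s = 1 - t"
  have s: "s > 0" "s + t = 1" using t by (auto simp: s_def)
  define w where "w = s * x + t * y"
  have w0: "w \<ge> 0" using x y s t by (auto simp: w_def)
  define m where "m = s * L x + t * L y"
  have ptw: "exp (- m) * exp (w * Y \<omega>)
      \<le> s * (exp (- L x) * exp (x * Y \<omega>)) + t * (exp (- L y) * exp (y * Y \<omega>))" for \<omega>
  proof -
    have "exp (- m) * exp (w * Y \<omega>) = exp (s * (x * Y \<omega> - L x) + t * (y * Y \<omega> - L y))"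
      by (simp add: exp_add[symmetric] m_def w_def algebra_simps)
    also have "\<dots> \<le> s * exp (x * Y \<omega> - L x) + t * exp (y * Y \<omega> - L y)"
      using convex_onD[OF exp_convex, of t "x * Y \<omega> - L x" "y * Y \<omega> - L y"] t
      by (simp add: s_def)
    finally show ?thesis by (simp add: exp_diff exp_minus field_simps)
  qed
  have "exp (- m) * expectation (\<lambda>\<omega>. exp (w * Y \<omega>))
      = expectation (\<lambda>\<omega>. exp (- m) * exp (w * Y \<omega>))" by simp
  also have "\<dots> \<le> expectation (\<lambda>\<omega>. s * (exp (- L x) * exp (x * Y \<omega>))
                                  + t * (exp (- L y) * exp (y * Y \<omega>)))"
    using int x y w0 ptw by (intro integral_mono) auto
  also have "\<dots> = s * (exp (- L x) * expectation (\<lambda>\<omega>. exp (x * Y \<omega>)))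
      + t * (exp (- L y) * expectation (\<lambda>\<omega>. exp (y * Y \<omega>)))"
    using int x y by (subst Bochner_Integration.integral_add) auto
  also have "\<dots> = 1" using expL x y s by simp
  finally have "expectation (\<lambda>\<omega>. exp (w * Y \<omega>)) \<le> exp m"
    by (simp add: exp_minus field_simps)
  then have "L w \<le> m"
    unfolding L_def[of w] using pos[OF w0] ln_le_cancel_iff[of _ "exp m"] by simp
  then show "ln (expectation (\<lambda>\<omega>. exp (((1 - t) *\<^sub>R x + t *\<^sub>R y) * Y \<omega>)))
      \<le> (1 - t) * ln (expectation (\<lambda>\<omega>. exp (x * Y \<omega>)))
        + t * ln (expectation (\<lambda>\<omega>. exp (y * Y \<omega>)))"
    by (simp add: L_def w_def m_def s_def)
qed simp

locale convex_exponent =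
  fixes \<psi> :: "real \<Rightarrow> real"
  assumes convex: "convex_on {0..} \<psi>"
    and zero: "\<psi> 0 = 0"
    and pos_somewhere: "\<exists>\<theta>>0. \<psi> \<theta> > 0"
begin

lemma below_chord:
  assumes "0 \<le> y" "y \<le> z" "0 < z"
  shows "\<psi> y \<le> y / z * \<psi> z"
  using convex_onD[OF convex, of "y / z" 0 z] assms zero by simp

lemma ex_root:
  assumes p: "p > 0"
  shows "\<exists>y>0. \<psi> y = p"
proof -
  (* The chord from the origin forces linear growth beyond a point of positivity (z is far enough
     out to exceed p) and smallness near the origin (e is close enough to stay below p).  The
     intermediate value theorem is applied on [e, z], inside the open half-line where convexity
     gives continuity. *)
  obtain a where a: "a > 0" "\<psi> a > 0" using pos_somewhere by blast
  define z where "z = max a (p / \<psi> a * a)"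
  have z: "z > 0" "a \<le> z" using a by (auto simp: z_def)
  have "p / \<psi> a * a \<le> z" by (simp add: z_def)
  then have "p \<le> z / a * \<psi> a" using a by (simp add: field_simps)
  also have "\<dots> \<le> \<psi> z" using below_chord[of a z] a z by (simp add: field_simps)
  finally have hi: "p \<le> \<psi> z" .
  define e where "e = min z (p * z / \<psi> z)"
  have e: "0 < e" "e \<le> z" using z p hi by (auto simp: e_def)
  have "e \<le> p * z / \<psi> z" by (simp add: e_def)
  then have "e / z * \<psi> z \<le> p" using z p hi by (simp add: field_simps)
  then have lo: "\<psi> e \<le> p" using below_chord[of e z] e z by simp
  have "continuous_on {0<..} \<psi>"
    by (rule convex_on_continuous) (auto intro: convex_on_subset[OF convex])
  then have "continuous_on {e..z} \<psi>" using e by (auto intro: continuous_on_subset)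
  then obtain y where "e \<le> y" "y \<le> z" "\<psi> y = p" using IVT'[of \<psi> e p z] lo hi e by auto
  with e show ?thesis by (intro exI[of _ y]) simp
qed

lemma strict_increase:
  assumes "0 \<le> y" "y < z" "\<psi> z > 0"
  shows "\<psi> y < \<psi> z"
proof -
  have "\<psi> y \<le> y / z * \<psi> z" using below_chord assms by simp
  also have "\<dots> < 1 * \<psi> z" using assms by (intro mult_strict_right_mono) auto
  finally show ?thesis by simp
qed

lemma weak_increase:
  assumes "0 < y" "y \<le> z" "\<psi> y > 0"
  shows "\<psi> y \<le> \<psi> z"
proof -
  have "\<psi> y \<le> y / z * \<psi> z" using below_chord assms by simp
  with assms have "0 < y / z * \<psi> z" by linarith
  then have "\<psi> z > 0" using assms by (simp add: zero_less_mult_iff zero_less_divide_iff)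
  then show ?thesis using strict_increase[of y z] assms by (cases "y = z") auto
qed

text \<open>
  A positive level is attained only once, so the supremum in the definition of the right inverse is
  taken over a single point.
\<close>

lemma right_inverse_unique:
  assumes p: "p > 0" and y: "y \<ge> 0" "\<psi> y = p"
  shows "right_inverse \<psi> p = y"
proof -
  have "z = y" if "z \<ge> 0" "\<psi> z = p" for z
    using strict_increase[of z y] strict_increase[of y z] that y p by (cases z y rule: linorder_cases) auto
  then have "{y. y \<ge> 0 \<and> \<psi> y = p} = {y}" using y by blast
  then show ?thesis by (simp add: right_inverse_def)
qed

lemma
  assumes "p > 0"
  shows right_inverse_pos: "right_inverse \<psi> p > 0"
    and exponent_right_inverse: "\<psi> (right_inverse \<psi> p) = p"
proof -
  obtain y where "y > 0" "\<psi> y = p" using ex_root[OF assms] by blast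
  moreover from this have "right_inverse \<psi> p = y" using right_inverse_unique[OF assms] by simp
  ultimately show "right_inverse \<psi> p > 0" "\<psi> (right_inverse \<psi> p) = p" by auto
qed

text \<open>
  The right inverse is the left adjoint of \<open>\<psi>\<close> on positive levels; its monotonicity, growth and
  right continuity are all read off from this equivalence.
\<close>

lemma less_right_inverse_iff:
  assumes "p > 0" "y \<ge> 0"
  shows "y < right_inverse \<psi> p \<longleftrightarrow> \<psi> y < p"
proof
  assume "y < right_inverse \<psi> p"
  then show "\<psi> y < p" using strict_increase[of y "right_inverse \<psi> p"] assms
    by (simp add: exponent_right_inverse)
next
  assume *: "\<psi> y < p"
  show "y < right_inverse \<psi> p"
  proof (rule ccontr)
    assume "\<not> ?thesis"
    then have "\<psi> (right_inverse \<psi> p) \<le> \<psi> y"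
      using weak_increase[of "right_inverse \<psi> p" y] assms
      by (simp add: exponent_right_inverse right_inverse_pos)
    then show False using * assms by (simp add: exponent_right_inverse)
  qed
qed

lemma right_inverse_strict_mono:
  assumes "0 < p" "p < p'"
  shows "right_inverse \<psi> p < right_inverse \<psi> p'"
  using less_right_inverse_iff[of p' "right_inverse \<psi> p"] assms right_inverse_pos[of p]
  by (simp add: exponent_right_inverse)

lemma right_inverse_at_top: "filterlim (right_inverse \<psi>) at_top at_top"
  unfolding filterlim_at_top_dense
proof
  fix K
  have "\<forall>\<^sub>F p in at_top. p > max 0 (\<psi> (max 0 K))" by (rule eventually_gt_at_top)
  then show "\<forall>\<^sub>F p in at_top. K < right_inverse \<psi> p"
  proof eventually_elim
    case (elim p)
    then show ?case using less_right_inverse_iff[of p "max 0 K"] by auto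
  qed
qed

lemma right_inverse_right_continuous:
  assumes "p > 0"
  shows "(right_inverse \<psi> \<longlongrightarrow> right_inverse \<psi> p) (at_right p)"
proof (rule order_tendstoI)
  fix a assume "a < right_inverse \<psi> p"
  then show "\<forall>\<^sub>F x in at_right p. a < right_inverse \<psi> x"
    using right_inverse_strict_mono[OF assms]
    by (intro eventually_at_rightI[of p "p + 1"]) (auto intro: less_trans)
next
  fix a assume a: "right_inverse \<psi> p < a"
  define b where "b = (right_inverse \<psi> p + a) / 2"
  have b: "right_inverse \<psi> p < b" "b < a" using a by (auto simp: b_def)
  have b0: "b > 0" using b right_inverse_pos[OF assms] by simp
  have "p \<le> \<psi> b" "\<psi> b \<noteq> p"
    using less_right_inverse_iff[OF assms, of b] right_inverse_unique[OF assms, of b] b b0 by auto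
  then have "p < \<psi> b" by simp
  then show "\<forall>\<^sub>F x in at_right p. right_inverse \<psi> x < a"
  proof (intro eventually_at_rightI[of p "\<psi> b"])
    fix x assume "x \<in> {p<..<\<psi> b}"
    then have "\<not> b < right_inverse \<psi> x" using less_right_inverse_iff[of x b] assms b0 by auto
    then show "right_inverse \<psi> x < a" using b by simp
  qed
qed

end

section \<open>The weighted tail of the second derivative\<close>

lemma nonneg_integral_truncation_tendsto:
  fixes f :: "real \<Rightarrow> real"
  assumes f: "f integrable_on {a..}" and nonneg: "\<And>x. x \<ge> a \<Longrightarrow> f x \<ge> 0"
  shows "((\<lambda>b. integral {a..b} f) \<longlongrightarrow> integral {a..} f) at_top"
proof -
  have abs: "f absolutely_integrable_on {a..}"
    using f nonneg by (intro nonnegative_absolutely_integrable_1) auto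
  have "((\<lambda>b. set_lebesgue_integral lebesgue {a..b} f) \<longlongrightarrow> set_lebesgue_integral lebesgue {a..} f) at_top"
    using abs by (intro tendsto_set_lebesgue_integral_at_top) auto
  moreover have "set_lebesgue_integral lebesgue {a..b} f = integral {a..b} f" for b
    by (intro set_lebesgue_integral_eq_integral set_integrable_subset[OF abs]) auto
  ultimately show ?thesis using set_lebesgue_integral_eq_integral(2)[OF abs] by simp
qed

text \<open>The substitute for the positivity of an integral from \<open>a\<close> to infinity.\<close>

lemma antitone_tendsto_zero_nonneg:
  fixes g :: "real \<Rightarrow> real"
  assumes deriv: "\<And>x. x \<ge> a \<Longrightarrow> \<exists>y. (g has_real_derivative y) (at x) \<and> y \<le> 0"
    and lim: "(g \<longlongrightarrow> 0) at_top"
  shows "g a \<ge> 0"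
proof (rule tendsto_upperbound[OF lim])
  show "\<forall>\<^sub>F x in at_top. g x \<le> g a"
    using eventually_ge_at_top[of a]
    by eventually_elim (rule DERIV_nonpos_imp_nonincreasing, simp_all add: deriv)
qed simp

text \<open>
  The analytic properties of the scale function that the sign analysis rests on; \<open>c0\<close> is the point
  beyond which its Laplace transform converges.
\<close>

locale scale_shape =
  fixes W :: "real \<Rightarrow> real" and bbar c0 :: real
  assumes nonneg: "\<And>x. W x \<ge> 0"
    and continuous: "continuous_on {0..} W"
    and increasing: "strict_mono_on {0..} W"
    and smooth: "smooth_on_pos W"
    and barrier: "classical_barrier W bbar"
    and abscissa_nonneg: "c0 \<ge> 0"
    and laplace_integrable: "\<And>\<theta>. \<theta> > c0 \<Longrightarrow> (\<lambda>x. exp (- \<theta> * x) * W x) integrable_on {0..}"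
begin

lemma bbar_nonneg: "bbar \<ge> 0"
  and second_deriv_neg: "0 < x \<Longrightarrow> x < bbar \<Longrightarrow> deriv (deriv W) x < 0"
  and second_deriv_pos: "bbar < x \<Longrightarrow> deriv (deriv W) x > 0"
  using barrier by (auto simp: classical_barrier_def)

lemma W_mono: "0 \<le> x \<Longrightarrow> x \<le> y \<Longrightarrow> W x \<le> W y"
  using strict_mono_onD[OF increasing, of x y] by (cases "x = y") auto

lemma has_deriv:
  assumes "x > 0"
  shows "(W has_real_derivative deriv W x) (at x)"
    and "(deriv W has_real_derivative deriv (deriv W) x) (at x)"
proof -
  have "(deriv ^^ 0) W field_differentiable (at x)" "(deriv ^^ 1) W field_differentiable (at x)"
    using smooth assms unfolding smooth_on_pos_def by blast+
  then show "(W has_real_derivative deriv W x) (at x)"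
    "(deriv W has_real_derivative deriv (deriv W) x) (at x)"
    by (auto simp: DERIV_deriv_iff_field_differentiable)
qed

lemma deriv_W_nonneg:
  assumes x: "x > 0"
  shows "deriv W x \<ge> 0"
proof (rule ccontr)
  assume "\<not> ?thesis"
  then obtain d where d: "d > 0" "\<And>h. 0 < h \<Longrightarrow> h < d \<Longrightarrow> W (x + h) < W x"
    using DERIV_neg_dec_right[OF has_deriv(1)[OF x]] by auto
  from d(2)[of "d / 2"] d(1) W_mono[of x "x + d / 2"] x show False by auto
qed

lemma deriv_W_mono:
  assumes "0 < x" "bbar \<le> x" "x \<le> y"
  shows "deriv W x \<le> deriv W y"
proof (cases "x = y")
  case False
  have "deriv W x < deriv W y"
  proof (rule DERIV_pos_imp_increasing_open[where f = "deriv W"])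
    fix z assume "x < z" "z < y"
    then show "\<exists>d. (deriv W has_real_derivative d) (at z) \<and> d > 0"
      using assms has_deriv(2)[of z] second_deriv_pos[of z] by (intro exI[of _ "deriv (deriv W) z"]) auto
  next
    show "continuous_on {x..y} (deriv W)"
      using assms by (intro continuous_at_imp_continuous_on ballI DERIV_isCont[OF has_deriv(2)]) auto
  qed (use assms False in auto)
  then show ?thesis by simp
qed simp

lemma deriv_W_antimono:
  assumes "0 < x" "x \<le> y" "y < bbar"
  shows "deriv W y \<le> deriv W x"
proof (rule DERIV_nonpos_imp_nonincreasing[OF assms(2)])
  fix z assume "x \<le> z" "z \<le> y"
  then show "\<exists>d. (deriv W has_real_derivative d) (at z) \<and> d \<le> 0"
    using assms has_deriv(2)[of z] second_deriv_neg[of z]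
    by (intro exI[of _ "deriv (deriv W) z"]) auto
qed

text \<open>
  A monotone function with a finite Laplace transform at \<open>\<theta>\<close> grows more slowly than
  \<open>exp (\<theta> * b)\<close>: its value at \<open>b\<close> is controlled by the integral over \<open>[b, b + 1]\<close>, which vanishes as
  a Cauchy difference of truncated integrals.
\<close>

lemma exp_W_tendsto_zero:
  assumes \<theta>: "\<theta> > c0"
  shows "((\<lambda>b. exp (- \<theta> * b) * W b) \<longlongrightarrow> 0) at_top"
proof (rule tendsto_sandwich[where f = "\<lambda>_. 0"])
  define f where "f = (\<lambda>x. exp (- \<theta> * x) * W x)"
  have f0: "f x \<ge> 0" for x by (simp add: f_def nonneg)
  have contf: "continuous_on {0..} f"
    unfolding f_def by (intro continuous_intros continuous)
  have lim: "((\<lambda>b. integral {0..b} f) \<longlongrightarrow> integral {0..} f) at_top"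
    using nonneg_integral_truncation_tendsto[of f 0] laplace_integrable[OF \<theta>] f0
    unfolding f_def by simp
  have "filterlim (\<lambda>b::real. 1 + b) at_top at_top"
    by (rule filterlim_tendsto_add_at_top[OF tendsto_const filterlim_ident])
  from filterlim_compose[OF lim this]
  have "((\<lambda>b. integral {0..b + 1} f) \<longlongrightarrow> integral {0..} f) at_top"
    by (simp only: add.commute[of 1])
  then have "((\<lambda>b. exp \<theta> * (integral {0..b + 1} f - integral {0..b} f))
      \<longlongrightarrow> exp \<theta> * (integral {0..} f - integral {0..} f)) at_top"
    by (intro tendsto_intros lim)
  then show "((\<lambda>b. exp \<theta> * (integral {0..b + 1} f - integral {0..b} f)) \<longlongrightarrow> 0) at_top" by simp
  show "\<forall>\<^sub>F b in at_top. exp (- \<theta> * b) * W b \<le> exp \<theta> * (integral {0..b + 1} f - integral {0..b} f)"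
    using eventually_ge_at_top[of 0]
  proof eventually_elim
    case (elim b)
    have int: "f integrable_on {0..b + 1}" "f integrable_on {b..b + 1}"
      using elim by (intro integrable_continuous_real continuous_on_subset[OF contf]; force)+
    have "integral {b..b + 1} (\<lambda>_. exp (- \<theta> * (b + 1)) * W b) \<le> integral {b..b + 1} f"
    proof (rule integral_le)
      fix x assume x: "x \<in> {b..b + 1}"
      have "\<theta> * x \<le> \<theta> * (b + 1)"
        using x \<theta> abscissa_nonneg by (intro mult_left_mono) auto
      then show "exp (- \<theta> * (b + 1)) * W b \<le> f x"
        unfolding f_def using W_mono[of b x] x elim nonneg by (intro mult_mono) auto
    qed (use int in auto)
    then have "exp (- \<theta> * (b + 1)) * W b \<le> integral {b..b + 1} f" by simp
    also have "\<dots> = integral {0..b + 1} f - integral {0..b} f"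
      using Henstock_Kurzweil_Integration.integral_combine[OF _ _ int(1), of b] elim by simp
    finally have "exp \<theta> * (exp (- \<theta> * (b + 1)) * W b)
        \<le> exp \<theta> * (integral {0..b + 1} f - integral {0..b} f)"
      by (intro mult_left_mono) auto
    moreover have "exp \<theta> * exp (- \<theta> * (b + 1)) = exp (- \<theta> * b)"
      by (simp add: exp_add[symmetric] algebra_simps)
    ultimately show ?case by (simp only: mult.assoc[symmetric])
  qed
qed (simp_all add: nonneg)

text \<open>
  Beyond \<open>bbar\<close> the function \<open>W\<close> is convex, so \<open>W' b\<close> is at most the increment of \<open>W\<close> over
  \<open>[b, b + 1]\<close> and inherits the decay.
\<close>

lemma exp_deriv_W_tendsto_zero:
  assumes \<theta>: "\<theta> > c0"
  shows "((\<lambda>b. exp (- \<theta> * b) * deriv W b) \<longlongrightarrow> 0) at_top"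
proof (rule tendsto_sandwich[where f = "\<lambda>_. 0"])
  have "filterlim (\<lambda>b::real. 1 + b) at_top at_top"
    by (rule filterlim_tendsto_add_at_top[OF tendsto_const filterlim_ident])
  from filterlim_compose[OF exp_W_tendsto_zero[OF \<theta>] this]
  have "((\<lambda>b. exp (- \<theta> * (1 + b)) * W (1 + b)) \<longlongrightarrow> 0) at_top" .
  from tendsto_mult[OF tendsto_const[of "exp \<theta>"] this]
  show "((\<lambda>b. exp \<theta> * (exp (- \<theta> * (1 + b)) * W (1 + b))) \<longlongrightarrow> 0) at_top" by simp
  show "\<forall>\<^sub>F b in at_top. exp (- \<theta> * b) * deriv W b \<le> exp \<theta> * (exp (- \<theta> * (1 + b)) * W (1 + b))"
    using eventually_gt_at_top[of bbar]
  proof eventually_elim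
    case (elim b)
    have b: "b > 0" using elim bbar_nonneg by simp
    obtain z where z: "b < z" "z < b + 1" "W (b + 1) - W b = (b + 1 - b) * deriv W z"
      using MVT2[of b "b + 1" W "deriv W"] has_deriv(1) b by auto
    have "deriv W b \<le> deriv W z" using deriv_W_mono[of b z] elim b z by simp
    also have "\<dots> \<le> W (1 + b)" using z nonneg[of b] by (simp add: add.commute)
    finally have "exp (- \<theta> * b) * deriv W b \<le> exp (- \<theta> * b) * W (1 + b)" by simp
    also have "exp (- \<theta> * b) * W (1 + b) = exp \<theta> * (exp (- \<theta> * (1 + b)) * W (1 + b))"
    proof -
      have "exp (- \<theta> * b) = exp \<theta> * exp (- \<theta> * (1 + b))"
        by (simp add: exp_add[symmetric] algebra_simps)
      then show ?thesis by (simp only: mult.assoc)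
    qed
    finally show ?case .
  qed
  show "\<forall>\<^sub>F b in at_top. 0 \<le> exp (- \<theta> * b) * deriv W b"
    using eventually_gt_at_top[of 0] by eventually_elim (simp add: deriv_W_nonneg)
qed simp

text \<open>
  Two integrations by parts identify this, for \<open>\<theta> > c0\<close>, with minus the integral of
  \<open>exp (- \<theta> * y) * W'' y\<close> over \<open>y\<close> from \<open>b\<close> to infinity. The difference in the last term is the
  Laplace integral of \<open>W\<close> over \<open>[b, \<infinity>)\<close>.
\<close>

definition tail :: "real \<Rightarrow> real \<Rightarrow> real" where
  "tail \<theta> b = exp (- \<theta> * b) * (deriv W b + \<theta> * W b)
     - \<theta>\<^sup>2 * (integral {0..} (\<lambda>x. exp (- \<theta> * x) * W x) - integral {0..b} (\<lambda>x. exp (- \<theta> * x) * W x))"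

lemma tail_has_deriv:
  assumes b: "b > 0"
  shows "(tail \<theta> has_real_derivative exp (- \<theta> * b) * deriv (deriv W) b) (at b)"
proof -
  define f where "f = (\<lambda>x. exp (- \<theta> * x) * W x)"
  have "continuous_on {0..b + 1} f"
    unfolding f_def by (intro continuous_intros continuous_on_subset[OF continuous]) auto
  from integral_has_real_derivative[OF this, of b]
  have "((\<lambda>x. integral {0..x} f) has_real_derivative f b) (at b within {0..b + 1})" using b by simp
  then have I: "((\<lambda>x. integral {0..x} f) has_real_derivative f b) (at b)"
    using b by (simp add: at_within_Icc_at)
  have "((\<lambda>b. exp (- \<theta> * b) * (deriv W b + \<theta> * W b) - \<theta>\<^sup>2 * (integral {0..} f - integral {0..b} f))
     has_real_derivative exp (- \<theta> * b) * deriv (deriv W) b) (at b)"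
    by (rule derivative_eq_intros has_deriv[OF b] I refl | simp)+
       (simp add: f_def algebra_simps power2_eq_square)
  then show ?thesis unfolding tail_def[abs_def] f_def .
qed

lemma tail_continuous_on: "A \<subseteq> {0<..} \<Longrightarrow> continuous_on A (tail \<theta>)"
  by (intro continuous_at_imp_continuous_on ballI DERIV_isCont[OF tail_has_deriv]) auto

lemma tail_tendsto_zero:
  assumes "\<theta> > c0"
  shows "(tail \<theta> \<longlongrightarrow> 0) at_top"
proof -
  define f where "f = (\<lambda>x. exp (- \<theta> * x) * W x)"
  have "((\<lambda>b. integral {0..b} f) \<longlongrightarrow> integral {0..} f) at_top"
    using laplace_integrable[OF assms] nonneg
    unfolding f_def by (intro nonneg_integral_truncation_tendsto) auto
  then have "((\<lambda>b. exp (- \<theta> * b) * deriv W b + \<theta> * (exp (- \<theta> * b) * W b)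
      - \<theta>\<^sup>2 * (integral {0..} f - integral {0..b} f))
    \<longlongrightarrow> 0 + \<theta> * 0 - \<theta>\<^sup>2 * (integral {0..} f - integral {0..} f)) at_top"
    by (intro tendsto_intros exp_W_tendsto_zero exp_deriv_W_tendsto_zero assms)
  then show ?thesis unfolding tail_def[abs_def] f_def by (simp add: algebra_simps)
qed

lemma tail_strict_antimono:
  assumes "0 < x" "x < y" "y \<le> bbar"
  shows "tail \<theta> y < tail \<theta> x"
proof (rule DERIV_neg_imp_decreasing_open[OF assms(2)])
  fix z assume "x < z" "z < y"
  then show "\<exists>d. (tail \<theta> has_real_derivative d) (at z) \<and> d < 0"
    using assms tail_has_deriv[of z \<theta>] second_deriv_neg[of z]
    by (intro exI[of _ "exp (- \<theta> * z) * deriv (deriv W) z"]) (auto simp: mult_pos_neg)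
qed (use assms in \<open>intro tail_continuous_on, auto\<close>)

lemma tail_strict_mono:
  assumes "0 < x" "bbar \<le> x" "x < y"
  shows "tail \<theta> x < tail \<theta> y"
proof (rule DERIV_pos_imp_increasing_open[OF assms(3)])
  fix z assume "x < z" "z < y"
  then show "\<exists>d. (tail \<theta> has_real_derivative d) (at z) \<and> d > 0"
    using assms tail_has_deriv[of z \<theta>] second_deriv_pos[of z]
    by (intro exI[of _ "exp (- \<theta> * z) * deriv (deriv W) z"]) auto
qed (use assms in \<open>intro tail_continuous_on, auto\<close>)

lemma tail_neg:
  assumes \<theta>: "\<theta> > c0" and b: "0 < b" "bbar \<le> b"
  shows "tail \<theta> b < 0"
proof -
  have "tail \<theta> (b + 1) \<le> 0"
  proof (rule tendsto_lowerbound[OF tail_tendsto_zero[OF \<theta>]])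
    show "\<forall>\<^sub>F x in at_top. tail \<theta> (b + 1) \<le> tail \<theta> x"
      using eventually_gt_at_top[of "b + 1"]
      by eventually_elim (use tail_strict_mono b in \<open>auto intro!: less_imp_le\<close>)
  qed simp
  then show ?thesis using tail_strict_mono[of b "b + 1" \<theta>] b by simp
qed

text \<open>
  The integrands differ by the factor \<open>exp ((\<theta>' - \<theta>) * (bbar - y))\<close>, which is at least \<open>1\<close> where
  \<open>- W''\<close> is positive and at most \<open>1\<close> where it is negative.
\<close>

lemma tail_le_weighted_tail:
  assumes \<theta>: "c0 < \<theta>" "\<theta> \<le> \<theta>'" and b: "b > 0"
  shows "tail \<theta> b \<le> exp ((\<theta>' - \<theta>) * bbar) * tail \<theta>' b"
proof -
  define g where "g x = exp ((\<theta>' - \<theta>) * bbar) * tail \<theta>' x - tail \<theta> x" for x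
  have "g b \<ge> 0"
  proof (rule antitone_tendsto_zero_nonneg[of b g])
    fix x assume "x \<ge> b"
    then have x: "x > 0" using b by simp
    define D where "D = exp ((\<theta>' - \<theta>) * bbar) * (exp (- \<theta>' * x) * deriv (deriv W) x)
      - exp (- \<theta> * x) * deriv (deriv W) x"
    have "(g has_real_derivative D) (at x)"
      unfolding g_def[abs_def] D_def by (intro DERIV_diff DERIV_cmult tail_has_deriv x)
    moreover have "D = exp (- \<theta> * x) * ((exp ((\<theta>' - \<theta>) * (bbar - x)) - 1) * deriv (deriv W) x)"
      by (simp add: D_def algebra_simps exp_add[symmetric])
    moreover have "(exp ((\<theta>' - \<theta>) * (bbar - x)) - 1) * deriv (deriv W) x \<le> 0"
    proof (cases x bbar rule: linorder_cases)
      case less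
      then show ?thesis using second_deriv_neg[OF x] \<theta> by (intro mult_nonneg_nonpos) auto
    next
      case greater
      then show ?thesis using second_deriv_pos[of x] \<theta>
        by (intro mult_nonpos_nonneg) (auto simp: mult_nonneg_nonpos)
    qed simp
    ultimately show "\<exists>y. (g has_real_derivative y) (at x) \<and> y \<le> 0"
      by (intro exI[of _ D]) (simp add: mult_nonneg_nonpos)
  next
    have "(g \<longlongrightarrow> exp ((\<theta>' - \<theta>) * bbar) * 0 - 0) at_top"
      unfolding g_def[abs_def] using \<theta> by (intro tendsto_intros tail_tendsto_zero) auto
    then show "(g \<longlongrightarrow> 0) at_top" by simp
  qed
  then show ?thesis by (simp add: g_def)
qed

text \<open>
  Split at a point \<open>d\<close> strictly between \<open>c\<close> and \<open>bbar\<close>, and compare with a fixed exponent \<open>\<alpha>\<close>. After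
  multiplication by \<open>exp ((\<theta> - \<alpha>) * bbar)\<close>, the part over \<open>[c, d]\<close> is at least
  \<open>exp ((\<theta> - \<alpha>) * (bbar - d))\<close> times its positive value \<open>J\<close> at \<open>\<alpha>\<close>, and the part beyond \<open>d\<close> is at
  least its value at \<open>\<alpha>\<close>.
\<close>

lemma tail_eventually_pos:
  assumes c: "0 < c" "c < bbar"
  shows "\<forall>\<^sub>F \<theta> in at_top. tail \<theta> c > 0"
proof -
  define \<alpha> where "\<alpha> = c0 + 1"
  define d where "d = (c + bbar) / 2"
  have d: "c < d" "d < bbar" using c by (auto simp: d_def)
  define J where "J = tail \<alpha> c - tail \<alpha> d"
  have J: "J > 0" using tail_strict_antimono[of c d \<alpha>] c d by (simp add: J_def)
  have "filterlim (\<lambda>\<theta>. - \<alpha> + \<theta>) at_top at_top"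
    by (rule filterlim_tendsto_add_at_top[OF tendsto_const filterlim_ident])
  then have "filterlim (\<lambda>\<theta>. (bbar - d) * (- \<alpha> + \<theta>)) at_top at_top"
    by (rule filterlim_tendsto_pos_mult_at_top[OF tendsto_const, rotated]) (use d in simp)
  then have "filterlim (\<lambda>\<theta>. exp ((bbar - d) * (- \<alpha> + \<theta>))) at_top at_top"
    by (rule filterlim_compose[OF exp_at_top])
  then have "filterlim (\<lambda>\<theta>. J * exp ((bbar - d) * (- \<alpha> + \<theta>))) at_top at_top"
    by (rule filterlim_tendsto_pos_mult_at_top[OF tendsto_const J])
  then have "\<forall>\<^sub>F \<theta> in at_top. J * exp ((bbar - d) * (- \<alpha> + \<theta>)) > - tail \<alpha> d"
    by (simp add: filterlim_at_top_dense)
  then show ?thesis using eventually_ge_at_top[of \<alpha>]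
  proof eventually_elim
    case (elim \<theta>)
    define \<delta> where "\<delta> = \<theta> - \<alpha>"
    have \<delta>: "\<delta> \<ge> 0" using elim by (simp add: \<delta>_def)
    define g where "g x = exp (\<delta> * bbar) * tail \<theta> x - exp (\<delta> * (bbar - d)) * tail \<alpha> x" for x
    have "g d \<le> g c"
    proof (rule DERIV_nonpos_imp_nonincreasing[where f = g])
      fix x assume "c \<le> x" "x \<le> d"
      then have x: "x > 0" "x \<le> d" "x < bbar" using c d by auto
      define D where "D = exp (\<delta> * bbar) * (exp (- \<theta> * x) * deriv (deriv W) x)
        - exp (\<delta> * (bbar - d)) * (exp (- \<alpha> * x) * deriv (deriv W) x)"
      have "(g has_real_derivative D) (at x)"
        unfolding g_def[abs_def] D_def by (intro DERIV_diff DERIV_cmult tail_has_deriv x)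
      moreover have "D = exp (- \<alpha> * x)
          * ((exp (\<delta> * (bbar - x)) - exp (\<delta> * (bbar - d))) * deriv (deriv W) x)"
        by (simp add: D_def \<delta>_def algebra_simps exp_add[symmetric])
      moreover have "(exp (\<delta> * (bbar - x)) - exp (\<delta> * (bbar - d))) * deriv (deriv W) x \<le> 0"
        using second_deriv_neg[of x] x \<delta> by (intro mult_nonneg_nonpos) (auto intro!: mult_left_mono)
      ultimately show "\<exists>y. (g has_real_derivative y) (at x) \<and> y \<le> 0"
        by (intro exI[of _ D]) (simp add: mult_nonneg_nonpos)
    qed (use d in simp)
    moreover have "tail \<alpha> d \<le> exp (\<delta> * bbar) * tail \<theta> d"
      using tail_le_weighted_tail[of \<alpha> \<theta> d] elim c d by (simp add: \<alpha>_def \<delta>_def)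
    ultimately have "exp (\<delta> * bbar) * tail \<theta> c \<ge> tail \<alpha> d + J * exp (\<delta> * (bbar - d))"
      by (simp add: g_def J_def algebra_simps)
    moreover have "J * exp (\<delta> * (bbar - d)) > - tail \<alpha> d"
      using elim(1) by (simp add: \<delta>_def algebra_simps)
    ultimately have "0 < exp (\<delta> * bbar) * tail \<theta> c" by linarith
    then show ?case by (simp add: zero_less_mult_iff)
  qed
qed

end

section \<open>Barriers as zeros of decreasing functions\<close>

text \<open>
  Monotonicity guarantees that the extended limit exists, so that the limit operator, which is
  unspecified for a divergent function, returns the actual one-sided limit.
\<close>

lemma lim_at_zero_right_increasing:
  fixes f :: "real \<Rightarrow> real"
  assumes d: "d > 0" and mono: "\<And>x y. 0 < x \<Longrightarrow> x \<le> y \<Longrightarrow> y < d \<Longrightarrow> f x \<le> f y"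
  shows "((\<lambda>x. ereal (f x)) \<longlongrightarrow> lim_at_zero_right f) (at_right 0)"
    and "0 < x \<Longrightarrow> x < d \<Longrightarrow> lim_at_zero_right f \<le> ereal (f x)"
proof -
  have "((\<lambda>x. ereal (f x)) \<longlongrightarrow> Inf ((\<lambda>x. ereal (f x)) ` ({0<..} \<inter> {..<d})))
      (at 0 within ({0<..} \<inter> {..<d}))"
    by (rule Lim_right_bound[where K = "-\<infinity>"]) (use mono in auto)
  moreover have "{0<..} \<inter> {..<d} = {0<..<d}" by auto
  moreover have "at 0 within {0<..<d} = at_right 0"
    by (rule at_within_nhd[of _ "{..<d}"]) (use d in auto)
  ultimately have lim: "((\<lambda>x. ereal (f x)) \<longlongrightarrow> Inf ((\<lambda>x. ereal (f x)) ` {0<..<d})) (at_right 0)" by simp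
  have eq: "lim_at_zero_right f = Inf ((\<lambda>x. ereal (f x)) ` {0<..<d})"
    unfolding lim_at_zero_right_def by (rule tendsto_Lim[OF _ lim]) simp
  show "((\<lambda>x. ereal (f x)) \<longlongrightarrow> lim_at_zero_right f) (at_right 0)"
    using lim eq by simp
  show "0 < x \<Longrightarrow> x < d \<Longrightarrow> lim_at_zero_right f \<le> ereal (f x)"
    unfolding eq by (rule INF_lower) auto
qed

lemma lim_at_zero_right_decreasing:
  fixes f :: "real \<Rightarrow> real"
  assumes d: "d > 0" and antimono: "\<And>x y. 0 < x \<Longrightarrow> x \<le> y \<Longrightarrow> y < d \<Longrightarrow> f y \<le> f x"
  shows "((\<lambda>x. ereal (f x)) \<longlongrightarrow> lim_at_zero_right f) (at_right 0)"
    and "0 < x \<Longrightarrow> x < d \<Longrightarrow> ereal (f x) \<le> lim_at_zero_right f"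
proof -
  note lim = lim_at_zero_right_increasing[of d "\<lambda>x. - f x", OF d]
  have "((\<lambda>x. - ereal (- f x)) \<longlongrightarrow> - lim_at_zero_right (\<lambda>x. - f x)) (at_right 0)"
    by (intro tendsto_uminus_ereal lim(1)) (use antimono in auto)
  then have t: "((\<lambda>x. ereal (f x)) \<longlongrightarrow> - lim_at_zero_right (\<lambda>x. - f x)) (at_right 0)" by simp
  have eq: "lim_at_zero_right f = - lim_at_zero_right (\<lambda>x. - f x)"
    unfolding lim_at_zero_right_def[of f] by (rule tendsto_Lim[OF _ t]) simp
  show "((\<lambda>x. ereal (f x)) \<longlongrightarrow> lim_at_zero_right f) (at_right 0)" using t eq by simp
  assume "0 < x" "x < d"
  then have "lim_at_zero_right (\<lambda>x. - f x) \<le> ereal (- f x)"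
    by (intro lim(2)) (use antimono in auto)
  then show "ereal (f x) \<le> lim_at_zero_right f" unfolding eq using ereal_minus_le_minus[of "- ereal (f x)" "lim_at_zero_right (\<lambda>x. - f x)"]
    by simp
qed

text \<open>
  The case distinction on the limit at zero collapses: in either case the barrier is the supremum
  of the points where \<open>h\<close> is nonnegative, or zero if there are none. If the limit is positive, then \<open>d > 0\<close> and the intermediate
  value theorem supplies the zero. If it is not, a point of nonnegativity would lie below \<open>d\<close>, and
  strict decrease would make \<open>h\<close>, and hence its limit, positive to the left of it.
\<close>

lemma decreasing_barrier:
  fixes h :: "real \<Rightarrow> real" and d :: real
  defines "B \<equiv> (if lim_at_zero_right h > 0
     then THE b. 0 < b \<and> b < d \<and> h b = 0 \<and> {c. c > 0 \<and> h c \<ge> 0} = {0<..b} else 0)"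
  assumes d: "d \<ge> 0"
    and cont: "continuous_on {0<..} h"
    and dec: "\<And>x y. 0 < x \<Longrightarrow> x < y \<Longrightarrow> y \<le> d \<Longrightarrow> h y < h x"
    and neg: "\<And>x. 0 < x \<Longrightarrow> d \<le> x \<Longrightarrow> h x < 0"
    and inc: "\<And>x y. 0 < x \<Longrightarrow> d \<le> x \<Longrightarrow> x < y \<Longrightarrow> h x < h y"
  shows "0 \<le> B" "B \<le> d" "\<And>c. c > 0 \<Longrightarrow> c \<le> B \<longleftrightarrow> h c \<ge> 0"
proof -
  have "0 \<le> B \<and> B \<le> d \<and> (\<forall>c>0. c \<le> B \<longleftrightarrow> h c \<ge> 0)"
  proof (cases "d = 0")
    case True
    have "lim_at_zero_right h \<le> ereal (h 1)"
      by (rule lim_at_zero_right_increasing[of 2]) (use inc True in \<open>auto simp: less_eq_real_def\<close>)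
    also have "\<dots> < 0" using neg[of 1] True by simp
    finally have "B = 0" by (simp add: B_def)
    moreover have "\<not> h c \<ge> 0" if "c > 0" for c using neg[of c] that True by simp
    ultimately show ?thesis using True by auto
  next
    case False
    then have d0: "d > 0" using d by simp
    note lim = lim_at_zero_right_decreasing[OF d0, of h]
    have dec': "h y \<le> h x" if "0 < x" "x \<le> y" "y \<le> d" for x y
      using dec[of x y] that by (cases "x = y") auto
    show ?thesis
    proof (cases "lim_at_zero_right h > 0")
      case True
      have "\<forall>\<^sub>F x in at_right 0. ereal (h x) > 0"
        by (rule order_tendstoD(1)[OF lim(1) True]) (use dec' in auto)
      then have "\<forall>\<^sub>F x in at_right 0. h x > 0 \<and> x \<in> {0<..<d}"
        using eventually_at_right_real[OF d0] by eventually_elim auto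
      then obtain x where x: "h x > 0" "0 < x" "x < d"
        using eventually_happens[of _ "at_right (0::real)"] by auto
      have "continuous_on {x..d} h" by (rule continuous_on_subset[OF cont]) (use x in auto)
      then obtain b where b: "x \<le> b" "b \<le> d" "h b = 0"
        using IVT2'[of h d 0 x] x neg[of d] d0 by auto
      have "b < d" using b neg[of d] d0 by (cases "b = d") auto
      have pos_iff: "h c \<ge> 0 \<longleftrightarrow> c \<le> b" if c: "c > 0" for c
      proof (cases "c \<le> b")
        case True
        then show ?thesis using dec'[of c b] b c by auto
      next
        case False
        then have "h c < 0" using dec[of b c] neg[of c] b c x by (cases "c \<le> d") auto
        then show ?thesis using False by simp
      qed
      have set_eq: "{c. c > 0 \<and> h c \<ge> 0} = {0<..b}" using pos_iff by auto
      have "(THE b. 0 < b \<and> b < d \<and> h b = 0 \<and> {c. c > 0 \<and> h c \<ge> 0} = {0<..b}) = b"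
      proof (rule the_equality)
        fix b' assume b': "0 < b' \<and> b' < d \<and> h b' = 0 \<and> {c. c > 0 \<and> h c \<ge> 0} = {0<..b'}"
        then have "{0<..b'} = {0<..b}" using set_eq by simp
        moreover have "b' \<in> {0<..b'}" "b \<in> {0<..b}" using b' x b by auto
        ultimately have "b' \<in> {0<..b}" "b \<in> {0<..b'}" by blast+
        then show "b' = b" by simp
      qed (use x b \<open>b < d\<close> set_eq in auto)
      then have "B = b" using True by (simp add: B_def)
      then show ?thesis using pos_iff x b by auto
    next
      case False
      then have "B = 0" by (simp add: B_def)
      moreover have "\<not> h c \<ge> 0" if c: "c > 0" for c
      proof (cases "c < d")
        case True
        have "ereal (h (c / 2)) \<le> lim_at_zero_right h"
          by (rule lim(2)) (use True c dec' in auto)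
        also have "\<dots> \<le> 0" using False by simp
        finally have "h (c / 2) \<le> 0" by simp
        then show ?thesis using dec[of "c / 2" c] c True by simp
      next
        case False
        then show ?thesis using neg[of c] c by simp
      qed
      ultimately show ?thesis using d by auto
    qed
  qed
  then show "0 \<le> B" "B \<le> d" "\<And>c. c > 0 \<Longrightarrow> c \<le> B \<longleftrightarrow> h c \<ge> 0" by auto
qed

section \<open>The periodic barrier as a function of the rate\<close>

locale periodic_barrier_setting =
  convex_exponent \<psi> + scale_shape W bbar "right_inverse \<psi> q"
  for \<psi> W :: "real \<Rightarrow> real" and bbar q :: real +
  assumes q_pos: "q > 0"
    and laplace: "\<And>\<theta>. \<theta> > right_inverse \<psi> q \<Longrightarrow>
      ((\<lambda>x. exp (- \<theta> * x) * W x) has_integral 1 / (\<psi> \<theta> - q)) {0..}"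
begin

abbreviation \<phi> :: "real \<Rightarrow> real" where
  "\<phi> r \<equiv> right_inverse \<psi> (q + r)"

lemma abscissa_less: "r > 0 \<Longrightarrow> right_inverse \<psi> q < \<phi> r"
  using right_inverse_strict_mono[of q "q + r"] q_pos by simp

lemma hfun_expand:
  "hfun \<psi> q W r b = exp (- \<phi> r * b) * (r * deriv W b + \<phi> r * r * W b)
     - (\<phi> r)\<^sup>2 * (1 - r * integral {0..b} (\<lambda>z. exp (- \<phi> r * z) * W z))"
proof -
  have e: "exp (- (\<phi> r * b)) * exp (\<phi> r * b) = 1" by (simp add: exp_add[symmetric])
  define I where "I = 1 - r * integral {0..b} (\<lambda>z. exp (- (\<phi> r * z)) * W z)"
  have "exp (- (\<phi> r * b)) * (r * deriv W b - \<phi> r * (\<phi> r * (exp (\<phi> r * b) * I) - r * W b))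
    = exp (- (\<phi> r * b)) * (r * deriv W b + \<phi> r * r * W b)
      - (\<phi> r)\<^sup>2 * I * (exp (- (\<phi> r * b)) * exp (\<phi> r * b))"
    by (simp add: algebra_simps power2_eq_square)
  then show ?thesis unfolding e by (simp add: hfun_def Zfun'_def Zfun_def Let_def I_def)
qed

lemma hfun_eq_tail:
  assumes r: "r > 0"
  shows "hfun \<psi> q W r b = r * tail (\<phi> r) b"
proof -
  have "integral {0..} (\<lambda>x. exp (- \<phi> r * x) * W x) = 1 / r"
    using integral_unique[OF laplace[OF abscissa_less[OF r]]] r q_pos
    by (simp add: exponent_right_inverse)
  then show ?thesis unfolding hfun_expand tail_def using r by (simp add: field_simps)
qed

lemma
  assumes r: "r > 0"
  shows periodic_barrier_nonneg: "0 \<le> periodic_barrier \<psi> q W bbar r"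
    and periodic_barrier_le_bbar: "periodic_barrier \<psi> q W bbar r \<le> bbar"
    and le_periodic_barrier_iff: "\<And>c. c > 0 \<Longrightarrow>
      c \<le> periodic_barrier \<psi> q W bbar r \<longleftrightarrow> hfun \<psi> q W r c \<ge> 0"
proof -
  have eq: "hfun \<psi> q W r = (\<lambda>b. r * tail (\<phi> r) b)" using hfun_eq_tail[OF r] by blast
  have cont: "continuous_on {0<..} (hfun \<psi> q W r)"
    unfolding eq by (intro continuous_intros tail_continuous_on) simp
  have dec: "hfun \<psi> q W r y < hfun \<psi> q W r x" if "0 < x" "x < y" "y \<le> bbar" for x y
    unfolding eq using tail_strict_antimono[OF that] r by simp
  have neg: "hfun \<psi> q W r x < 0" if "0 < x" "bbar \<le> x" for x
    unfolding eq using tail_neg[OF abscissa_less[OF r] that] r by (simp add: mult_pos_neg)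
  have inc: "hfun \<psi> q W r x < hfun \<psi> q W r y" if "0 < x" "bbar \<le> x" "x < y" for x y
    unfolding eq using tail_strict_mono[OF that] r by simp
  note * = decreasing_barrier[OF bbar_nonneg cont dec neg inc, folded periodic_barrier_def]
  show "0 \<le> periodic_barrier \<psi> q W bbar r" "periodic_barrier \<psi> q W bbar r \<le> bbar"
    and "\<And>c. c > 0 \<Longrightarrow> c \<le> periodic_barrier \<psi> q W bbar r \<longleftrightarrow> hfun \<psi> q W r c \<ge> 0"
    by (rule *; assumption)+
qed

text \<open>
  If the barrier at \<open>r\<close> is a positive \<open>c\<close>, then \<open>hfun\<close> is nonnegative at \<open>c\<close> for \<open>r\<close>, hence for every
  larger rate, and the barrier at that rate is at least \<open>c\<close>.
\<close>

lemma periodic_barrier_mono: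
  assumes r: "0 < r" "r \<le> r'"
  shows "periodic_barrier \<psi> q W bbar r \<le> periodic_barrier \<psi> q W bbar r'"
proof (cases "periodic_barrier \<psi> q W bbar r = 0")
  case True
  then show ?thesis using periodic_barrier_nonneg[of r'] r by simp
next
  case False
  define c where "c = periodic_barrier \<psi> q W bbar r"
  have c: "c > 0" using False periodic_barrier_nonneg[OF r(1)] by (simp add: c_def)
  have "hfun \<psi> q W r c \<ge> 0" using le_periodic_barrier_iff[OF r(1) c] by (simp add: c_def)
  then have "0 \<le> tail (\<phi> r) c" using r by (simp add: hfun_eq_tail zero_le_mult_iff)
  also have "\<dots> \<le> exp ((\<phi> r' - \<phi> r) * bbar) * tail (\<phi> r') c"
  proof (rule tail_le_weighted_tail[OF abscissa_less[OF r(1)] _ c])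
    show "\<phi> r \<le> \<phi> r'"
      using right_inverse_strict_mono[of "q + r" "q + r'"] r q_pos by (cases "r = r'") auto
  qed
  finally have "hfun \<psi> q W r' c \<ge> 0" using r by (simp add: hfun_eq_tail zero_le_mult_iff)
  then show ?thesis using le_periodic_barrier_iff[of r' c] r c by (simp add: c_def)
qed

lemma periodic_barrier_tendsto_bbar: "(periodic_barrier \<psi> q W bbar \<longlongrightarrow> bbar) at_top"
proof (rule order_tendstoI)
  fix a assume "bbar < a"
  show "\<forall>\<^sub>F r in at_top. periodic_barrier \<psi> q W bbar r < a"
    using eventually_gt_at_top[of 0]
    by eventually_elim (rule le_less_trans[OF periodic_barrier_le_bbar \<open>bbar < a\<close>])
next
  fix a assume a: "a < bbar"
  show "\<forall>\<^sub>F r in at_top. a < periodic_barrier \<psi> q W bbar r"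
  proof (cases "a < 0")
    case True
    show ?thesis using eventually_gt_at_top[of 0]
      by eventually_elim (rule less_le_trans[OF True periodic_barrier_nonneg])
  next
    case False
    define c where "c = (a + bbar) / 2"
    have c: "0 < c" "a < c" "c < bbar" using a False by (auto simp: c_def)
    have "filterlim \<phi> at_top at_top"
      by (intro filterlim_compose[OF right_inverse_at_top]
        filterlim_tendsto_add_at_top[OF tendsto_const filterlim_ident])
    then have "\<forall>\<^sub>F r in at_top. tail (\<phi> r) c > 0"
      using tail_eventually_pos[OF c(1,3)] by (rule eventually_compose_filterlim[rotated])
    then show ?thesis using eventually_gt_at_top[of 0]
    proof eventually_elim
      case (elim r)
      then have "c \<le> periodic_barrier \<psi> q W bbar r"
        using le_periodic_barrier_iff[of r c] c(1) by (simp add: hfun_eq_tail)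
      then show ?case using c by simp
    qed
  qed
qed

text \<open>
  The bound \<open>U r\<close> of the proof does not depend on the point \<open>c\<close>, and tends to minus the square of
  the right inverse of \<open>\<psi>\<close> at \<open>q\<close>. Uniformity in \<open>c\<close> is what makes the barrier vanish, and not merely
  become small, when \<open>W'\<close> is bounded near zero.
\<close>

lemma hfun_eventually_neg:
  assumes C: "C \<ge> 0"
  shows "\<forall>\<^sub>F r in at_right 0. \<forall>c. 0 < c \<and> c \<le> C \<and> deriv W c \<le> K \<longrightarrow> hfun \<psi> q W r c < 0"
proof -
  define U where "U r = r * K + \<phi> r * r * W C - (\<phi> r)\<^sup>2 * (1 - r * (C * W C))" for r
  have \<phi>_lim: "(\<phi> \<longlongrightarrow> right_inverse \<psi> q) (at_right 0)"
    using right_inverse_right_continuous[OF q_pos] filterlim_at_right_to_0[of "right_inverse \<psi>" _ q]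
    by (simp add: add.commute)
  have "(U \<longlongrightarrow> 0 * K + right_inverse \<psi> q * 0 * W C
      - (right_inverse \<psi> q)\<^sup>2 * (1 - 0 * (C * W C))) (at_right 0)"
    unfolding U_def[abs_def] by (intro tendsto_intros \<phi>_lim)
  then have "(U \<longlongrightarrow> - (right_inverse \<psi> q)\<^sup>2) (at_right 0)" by simp
  then have "\<forall>\<^sub>F r in at_right 0. U r < 0"
    by (rule order_tendstoD(2)) (use right_inverse_pos[OF q_pos] in simp)
  then show ?thesis using eventually_at_right_less[of "0::real"]
  proof eventually_elim
    case (elim r)
    show ?case
    proof (intro allI impI, elim conjE)
      fix c assume c: "0 < c" "c \<le> C" "deriv W c \<le> K"
      have \<phi>: "\<phi> r > 0" using right_inverse_pos elim q_pos by simp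
      have WcC: "W c \<le> W C" using W_mono c by simp
      have "integral {0..c} (\<lambda>z. exp (- \<phi> r * z) * W z) \<le> integral {0..c} (\<lambda>_. W c)"
      proof (rule integral_le)
        show "(\<lambda>z. exp (- \<phi> r * z) * W z) integrable_on {0..c}"
          by (intro integrable_continuous_real continuous_intros continuous_on_subset[OF continuous]) auto
        fix z assume z: "z \<in> {0..c}"
        have "exp (- \<phi> r * z) * W z \<le> 1 * W z"
          using z \<phi> nonneg by (intro mult_right_mono) auto
        then show "exp (- \<phi> r * z) * W z \<le> W c" using W_mono[of z c] z by simp
      qed (rule integrable_const_ivl)
      also have "\<dots> = c * W c" using c by simp
      also have "\<dots> \<le> C * W C" using c WcC nonneg C by (intro mult_mono) auto
      finally have I: "integral {0..c} (\<lambda>z. exp (- \<phi> r * z) * W z) \<le> C * W C" .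
      have "exp (- \<phi> r * c) * (r * deriv W c + \<phi> r * r * W c) \<le> 1 * (r * K + \<phi> r * r * W C)"
        using c elim \<phi> WcC nonneg deriv_W_nonneg[OF c(1)]
        by (intro mult_mono add_mono mult_left_mono) auto
      moreover have "(\<phi> r)\<^sup>2 * (1 - r * (C * W C))
          \<le> (\<phi> r)\<^sup>2 * (1 - r * integral {0..c} (\<lambda>z. exp (- \<phi> r * z) * W z))"
        using I elim by (intro mult_left_mono diff_left_mono) auto
      ultimately have "hfun \<psi> q W r c \<le> U r" unfolding hfun_expand U_def by simp
      then show "hfun \<psi> q W r c < 0" using elim by simp
    qed
  qed
qed

text \<open>
  Near zero \<open>W'\<close> is increasing if \<open>bbar = 0\<close>, hence bounded by its value at \<open>1\<close>, and otherwise
  decreasing, hence bounded by its limit.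
\<close>

lemma deriv_W_bounded_near_zero:
  assumes fin: "lim_at_zero_right (deriv W) < \<infinity>"
  obtains K \<delta> where "\<delta> > 0" "\<And>c. 0 < c \<Longrightarrow> c \<le> \<delta> \<Longrightarrow> deriv W c \<le> K"
proof (cases "bbar = 0")
  case True
  show ?thesis by (rule that[of 1 "deriv W 1"]) (use deriv_W_mono True in auto)
next
  case False
  then have b: "bbar > 0" using bbar_nonneg by simp
  have le: "ereal (deriv W c) \<le> lim_at_zero_right (deriv W)" if "0 < c" "c < bbar" for c
    by (rule lim_at_zero_right_decreasing(2)[OF b]) (use deriv_W_antimono that in auto)
  from le[of "bbar / 2"] fin b obtain K where "lim_at_zero_right (deriv W) = ereal K"
    by (cases "lim_at_zero_right (deriv W)") auto
  then show ?thesis using that[of "bbar / 2" K] le b by auto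
qed

lemma periodic_barrier_eventually_less:
  assumes c: "c > 0"
  shows "\<forall>\<^sub>F r in at_right 0. periodic_barrier \<psi> q W bbar r < c"
  using hfun_eventually_neg[OF less_imp_le[OF c], of "deriv W c"] eventually_at_right_less[of "0::real"]
proof eventually_elim
  case (elim r)
  have "hfun \<psi> q W r c < 0" using elim(1)[rule_format, of c] c by simp
  then show ?case using le_periodic_barrier_iff[OF elim(2) c] by simp
qed

lemma periodic_barrier_tendsto_zero: "(periodic_barrier \<psi> q W bbar \<longlongrightarrow> 0) (at_right 0)"
proof (rule order_tendstoI)
  fix a :: real assume a: "a < 0"
  show "\<forall>\<^sub>F r in at_right 0. a < periodic_barrier \<psi> q W bbar r"
    using eventually_at_right_less[of "0::real"]
    by eventually_elim (rule less_le_trans[OF a periodic_barrier_nonneg])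
qed (rule periodic_barrier_eventually_less)

text \<open>
  The barrier eventually lies below a \<open>\<delta>\<close> up to which \<open>W'\<close> is bounded, and \<open>hfun\<close> is eventually
  negative on all of \<open>(0, \<delta>]\<close>; a positive barrier would be a point of this interval at which \<open>hfun\<close>
  is nonnegative.
\<close>

lemma periodic_barrier_eventually_zero:
  assumes fin: "lim_at_zero_right (deriv W) < \<infinity>"
  shows "\<forall>\<^sub>F r in at_right 0. periodic_barrier \<psi> q W bbar r = 0"
proof -
  obtain K \<delta> where \<delta>: "\<delta> > 0" and K: "\<And>c. 0 < c \<Longrightarrow> c \<le> \<delta> \<Longrightarrow> deriv W c \<le> K"
    using deriv_W_bounded_near_zero[OF fin] by blast
  show ?thesis
    using hfun_eventually_neg[OF less_imp_le[OF \<delta>], of K]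
      periodic_barrier_eventually_less[OF \<delta>] eventually_at_right_less[of "0::real"]
  proof eventually_elim
    case (elim r)
    define b where "b = periodic_barrier \<psi> q W bbar r"
    have "\<not> b > 0"
    proof
      assume "b > 0"
      then have "hfun \<psi> q W r b \<ge> 0" using le_periodic_barrier_iff[of r b] elim by (simp add: b_def)
      moreover have "hfun \<psi> q W r b < 0" using elim K \<open>b > 0\<close> by (simp add: b_def)
      ultimately show False by simp
    qed
    then show ?case using periodic_barrier_nonneg[of r] elim by (simp add: b_def)
  qed
qed

end

theorem lemma6p1:
  fixes M :: "'a measure" and X :: "real \<Rightarrow> 'a \<Rightarrow> real"
    and \<gamma> \<eta> q bbar :: real and \<nu> :: "real measure"
    and \<psi> \<pi> W :: "real \<Rightarrow> real"
  assumes X: "spectrally_negative_levy M X"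
    and \<eta>: "\<eta> \<ge> 0"
    and \<nu>: "neg_levy_measure \<nu>"
    and \<psi>_def: "\<psi> = laplace_exponent \<gamma> \<eta> \<nu>"
    and \<psi>_X: "\<And>\<theta>. \<theta> \<ge> 0 \<Longrightarrow>
       integrable M (\<lambda>\<omega>. exp (\<theta> * X 1 \<omega>)) \<and> \<psi> \<theta> = ln (\<integral>\<omega>. exp (\<theta> * X 1 \<omega>) \<partial>M)"
    and dens: "dual_levy_density \<nu> \<pi>"
    and cm: "completely_monotone_derivs \<pi>"
    and q: "q > 0"
    and W: "scale_function \<psi> q W"
    and W_smooth: "smooth_on_pos W"
    and bbar: "classical_barrier W bbar"
  shows "(\<forall>r r'. 0 < r \<and> r \<le> r' \<longrightarrow>
            periodic_barrier \<psi> q W bbar r \<le> periodic_barrier \<psi> q W bbar r') \<and>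
         (periodic_barrier \<psi> q W bbar \<longlongrightarrow> bbar) at_top \<and>
         (lim_at_zero_right (deriv W) < \<infinity> \<longrightarrow>
            (\<forall>\<^sub>F r in at_right 0. periodic_barrier \<psi> q W bbar r = 0)) \<and>
         (lim_at_zero_right (deriv W) = \<infinity> \<longrightarrow>
            (periodic_barrier \<psi> q W bbar \<longlongrightarrow> 0) (at_right 0))"
proof -
  interpret prob_space M
    using X by (simp add: spectrally_negative_levy_def levy_process_def)
  have laplace: "((\<lambda>x. exp (- \<theta> * x) * W x) has_integral 1 / (\<psi> \<theta> - q)) {0..}"
    if "\<theta> > right_inverse \<psi> q" for \<theta>
    using W that by (auto simp: scale_function_def)
  have W_nonneg: "W x \<ge> 0" for x using W by (simp add: scale_function_def)
  have "convex_on {0..} (\<lambda>\<theta>. ln (expectation (\<lambda>\<omega>. exp (\<theta> * X 1 \<omega>))))"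
    by (rule convex_on_cumulant) (use \<psi>_X in blast)
  then have conv: "convex_on {0..} \<psi>"
    unfolding convex_on_def by (simp add: \<psi>_X)
  have zero: "\<psi> 0 = 0" using \<psi>_X[of 0] by (simp add: prob_space)
  (* The convergence half-line is shifted to the right of zero so that a is a positive point. *)
  define a where "a = max 1 (right_inverse \<psi> q + 1)"
  have "1 / (\<psi> a - q) \<ge> 0"
    by (rule has_integral_nonneg[OF laplace[of a]]) (auto simp: a_def W_nonneg)
  then have "\<psi> a \<ge> q" by (simp add: zero_le_divide_iff)
  then have pos: "\<exists>\<theta>>0. \<psi> \<theta> > 0" using q by (intro exI[of _ a]) (auto simp: a_def)
  interpret convex_exponent \<psi> by unfold_locales (fact conv zero pos)+
  interpret periodic_barrier_setting \<psi> W bbar q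
  proof unfold_locales
    show "continuous_on {0..} W" "strict_mono_on {0..} W"
      using W by (simp_all add: scale_function_def)
    show "right_inverse \<psi> q \<ge> 0" using right_inverse_pos[OF q] by simp
    show "(\<lambda>x. exp (- \<theta> * x) * W x) integrable_on {0..}" if "\<theta> > right_inverse \<psi> q" for \<theta>
      using laplace[OF that] by (rule has_integral_integrable)
  qed (fact W_nonneg W_smooth bbar q laplace)+
  show ?thesis
    using periodic_barrier_mono periodic_barrier_tendsto_bbar
      periodic_barrier_eventually_zero periodic_barrier_tendsto_zero by blast
qed

end
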